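(* Let $p\ge 1$ be an integer and let $V:\mathbb{Z}\to\mathbb{R}$ be a $p$-periodic potential, with associated Jacobi matrix $(Hu)(n)=u(n+1)+u(n-1)+V(n)u(n)$ on $l^2(\mathbb{Z})$. Let $B_j=[a_j,b_j]$, $j=1,\ldots,p$, be the $p$ bands of $\sigma(H)$, with $$a_1<b_1\leq a_2<b_2\leq\cdots\leq a_p<b_p.$$ Let $G_0=(-\infty,a_1)$ and $G_p=(b_p,\infty)$ be the unbounded gaps, and for $j=1,\ldots,p-1$ let $G_j$ be the open or collapsed gap separating $B_j$ and $B_{j+1}$, that is, $G_j=(b_j,a_{j+1})$ if $b_j<a_{j+1}$ and $G_j=\{b_j\}=\{a_{j+1}\}$ if $b_j=a_{j+1}$. Then the integrated density of states $k^H$ of $H$ satisfies $$k^H(E)=\begin{cases}\dfrac{j}{p}, & E\in G_j,\ j=0,\ldots,p,\\[2mm] \dfrac{j}{p}-\dfrac{\vartheta}{\pi}, & E\in B_j,\ 1\leq j\leq p,\ p-j=2m,\ m\in\mathbb{Z},\\[2mm] \dfrac{j-1}{p}+\dfrac{\vartheta}{\pi}, & E\in B_j,\ 1\leq j\leq p,\ p-j=2m-1,\ m\in\mathbb{Z},\end{cases}$$ where, for $E\in\sigma(H)$, $\vartheta\in[0,\pi/p]$ is determined by $D(E)=2\cos p\vartheta$, with $D$ the discriminant of $H$.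
   Context: Transfer matrix and discriminant: for $E\in\mathbb{C}$, $M_E(n)$ denotes the transfer matrix of the eigenvalue equation $Hu=Eu$, i.e. $u(n+1)+u(n-1)+V(n)u(n)=Eu(n)$ for all $n\in\mathbb{Z}$ (with $u$ not required to be in $l^2$); thus $(u(n+1),u(n))^T=M_E(n)\,(u(1),u(0))^T$ for every solution $u$. The discriminant is $D(E)=\operatorname{Tr}M_E(p)$, a real polynomial of degree $p$ in $E$. Bands: for $p$-periodic $V$, $\sigma(H)=\{E\in\mathbb{R}: -2\le D(E)\le 2\}$ is the union of $p$ compact intervals (the bands) $B_1,\ldots,B_p$, listed in increasing order, each mapped bijectively and monotonically by $D$ onto $[-2,2]$; consecutive bands may share an endpoint. Equivalently, the bands are the closures of the $p$ connected components of $\{E\in\mathbb{R}: |D(E)|<2\}$. Integrated density of states (IDS): for $\theta\in\mathbb{R}$ and an integer $L\geq 2$, let $H_L$ be the restriction of $H$ to $[1,L-1]\cap\mathbb{Z}$ with boundary conditions $u(0)/u(1)=\cot\theta$, $u(L)=0$, and for $E\in\mathbb{R}$ put $$k_L^H(E)=\frac{1}{L-1}\#\{\lambda\in\sigma(H_L):\lambda\le E\}.$$ The limit $k^H(E)=\lim_{L\to\infty}k_L^H(E)$ exists and is independent of $\theta$; it is called the integrated density of states of $H$. *)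

theory Defs
  imports "HOL-Analysis.Analysis"
begin

definition periodic_potential :: "(int \<Rightarrow> real) \<Rightarrow> nat \<Rightarrow> bool" where
  "periodic_potential V p \<longleftrightarrow> (\<forall>n. V (n + int p) = V n)"

definition jacobi :: "(int \<Rightarrow> real) \<Rightarrow> (int \<Rightarrow> complex) \<Rightarrow> int \<Rightarrow> complex" where
  "jacobi V u n = u (n + 1) + u (n - 1) + of_real (V n) * u n"

definition l2 :: "(int \<Rightarrow> complex) set" where
  "l2 = {u. (\<lambda>n. (norm (u n))\<^sup>2) summable_on UNIV}"

definition l2_norm :: "(int \<Rightarrow> complex) \<Rightarrow> real" where
  "l2_norm u = sqrt (\<Sum>\<^sub>\<infinity>n. (norm (u n))\<^sup>2)"

text \<open>The spectrum of \<open>jacobi V\<close> as an operator on \<open>l2\<close>, for bounded \<open>V\<close> (so that \<open>jacobi V\<close>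
  is a bounded operator on \<open>l2\<close>): the resolvent set consists of all \<open>z\<close> for which
  \<open>jacobi V - z\<close> has a bounded inverse on \<open>l2\<close>.\<close>

definition jacobi_resolvent_set :: "(int \<Rightarrow> real) \<Rightarrow> complex set" where
  "jacobi_resolvent_set V =
     {z. bij_betw (\<lambda>u n. jacobi V u n - z * u n) l2 l2 \<and>
         (\<exists>C. \<forall>u\<in>l2. l2_norm u \<le> C * l2_norm (\<lambda>n. jacobi V u n - z * u n))}"

definition jacobi_spectrum :: "(int \<Rightarrow> real) \<Rightarrow> complex set" where
  "jacobi_spectrum V = - jacobi_resolvent_set V"

text \<open>The field is kept generic: for complex \<open>E\<close> this is the usual transfer matrix, with
  \<open>(u (n + 1), u n) = transfer_matrix V E n *v (u 1, u 0)\<close> for every solution \<open>u\<close> of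
  \<open>jacobi V u = E u\<close>; for real \<open>E\<close> all entries are real and the real instance is used.\<close>

primrec transfer_matrix :: "(int \<Rightarrow> real) \<Rightarrow> 'a::real_field \<Rightarrow> nat \<Rightarrow> 'a^2^2" where
  "transfer_matrix V E 0 = mat 1"
| "transfer_matrix V E (Suc n) =
     vector [vector [E - of_real (V (int (Suc n))), -1], vector [1, 0]] ** transfer_matrix V E n"

definition discriminant :: "(int \<Rightarrow> real) \<Rightarrow> nat \<Rightarrow> 'a::real_field \<Rightarrow> 'a" where
  "discriminant V p E = trace (transfer_matrix V E p)"

text \<open>The intervals \<open>{a j..b j}\<close>, \<open>1 \<le> j \<le> p\<close>, are the bands of the spectrum in increasing order;
  consecutive bands may touch.  Mapping each band onto \<open>{-2..2}\<close> is what separates touching bands.\<close>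

definition spectral_bands ::
    "(int \<Rightarrow> real) \<Rightarrow> nat \<Rightarrow> (nat \<Rightarrow> real) \<Rightarrow> (nat \<Rightarrow> real) \<Rightarrow> bool" where
  "spectral_bands V p a b \<longleftrightarrow>
     (\<forall>j\<in>{1..p}. a j < b j) \<and> (\<forall>j\<in>{1..<p}. b j \<le> a (j + 1)) \<and>
     jacobi_spectrum V = complex_of_real ` (\<Union>j\<in>{1..p}. {a j..b j}) \<and>
     (\<forall>j\<in>{1..p}. bij_betw (discriminant V p) {a j..b j} {-2..2} \<and>
        (mono_on {a j..b j} (discriminant V p) \<or> antimono_on {a j..b j} (discriminant V p)))"

definition spectral_gap :: "nat \<Rightarrow> (nat \<Rightarrow> real) \<Rightarrow> (nat \<Rightarrow> real) \<Rightarrow> nat \<Rightarrow> real set" where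
  "spectral_gap p a b j =
     (if j = 0 then {..<a 1}
      else if j = p then {b p<..}
      else if b j < a (j + 1) then {b j<..<a (j + 1)}
      else {b j})"

text \<open>Eigenvalues of the restriction of \<open>jacobi V\<close> to \<open>[1, L - 1]\<close> with \<open>u(0)/u(1) = cot \<theta>\<close> and
  \<open>u(L) = 0\<close>.  The left condition is written homogeneously, so that for \<open>sin \<theta> = 0\<close> it reads
  \<open>u(1) = 0\<close>.  All eigenvalues are simple, since the left condition fixes \<open>(u(0), u(1))\<close>
  up to scaling; hence counting distinct eigenvalues counts them with multiplicity.\<close>

definition restricted_spectrum :: "(int \<Rightarrow> real) \<Rightarrow> real \<Rightarrow> nat \<Rightarrow> complex set" where
  "restricted_spectrum V \<theta> L =
     {z. \<exists>u. (\<exists>n\<in>{1..int L - 1}. u n \<noteq> 0) \<and>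
             u 0 * of_real (sin \<theta>) = u 1 * of_real (cos \<theta>) \<and> u (int L) = 0 \<and>
             (\<forall>n\<in>{1..int L - 1}. jacobi V u n = z * u n)}"

definition ids_restricted :: "(int \<Rightarrow> real) \<Rightarrow> real \<Rightarrow> nat \<Rightarrow> real \<Rightarrow> real" where
  "ids_restricted V \<theta> L E =
     real (card {x::real. of_real x \<in> restricted_spectrum V \<theta> L \<and> x \<le> E}) / (real L - 1)"

definition ids :: "(int \<Rightarrow> real) \<Rightarrow> real \<Rightarrow> real" where
  "ids V E = (THE k. \<forall>\<theta>. (\<lambda>L. ids_restricted V \<theta> L E) \<longlonglongrightarrow> k)"

definition bloch_angle :: "(int \<Rightarrow> real) \<Rightarrow> nat \<Rightarrow> real \<Rightarrow> real" where
  "bloch_angle V p E =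
     (THE \<theta>. \<theta> \<in> {0..pi / real p} \<and> discriminant V p E = 2 * cos (real p * \<theta>))"

end

theory Submission
  imports Defs "HOL-Computational_Algebra.Polynomial"
begin

text \<open>
  Write \<open>Q n\<close> for the value at \<open>n\<close> of the solution with \<open>(u 0, u 1) = (cos \<theta>, sin \<theta>)\<close>, a polynomial in
  the energy; the eigenvalues of \<open>H\<^sub>L\<close> are the zeros of \<open>Q L\<close>.  By Cayley--Hamilton and periodicity,
  \<open>Q (n + 2 p) = D Q (n + p) - Q n\<close>, so \<open>m \<mapsto> Q (m p + r)\<close> is a combination of Chebyshev polynomials
  in \<open>D\<close>, and where \<open>D = 2 cos (k \<pi> / m)\<close> it equals \<open>(-1)\<^sup>k Q r\<close>.  As \<open>Q r\<close> has boundedly many zeros,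
  these sign changes force, in each part of a band, as many zeros of \<open>Q (m p + r)\<close> as it contains nodes,
  up to \<open>O(1)\<close>.  Counting below and above \<open>E\<close> gives two lower bounds whose sum already is the degree up to
  \<open>O(1)\<close>, so both are sharp and the limit follows for every \<open>\<theta>\<close> without any oscillation theory.
\<close>

section \<open>Solutions as polynomials in the energy\<close>

text \<open>The eigenvalue equation solved for \<open>u (n + 1)\<close>, with the energy as
  indeterminate and \<open>u 0 = \<alpha>\<close>, \<open>u 1 = \<beta>\<close>. The initial values
  stay parameters because translation by a period replaces them.\<close>

fun jacobi_poly :: "(int \<Rightarrow> real) \<Rightarrow> real \<Rightarrow> real \<Rightarrow> nat \<Rightarrow> real poly" where
  "jacobi_poly V \<alpha> \<beta> 0 = [:\<alpha>:]"
| "jacobi_poly V \<alpha> \<beta> (Suc 0) = [:\<beta>:]"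
| "jacobi_poly V \<alpha> \<beta> (Suc (Suc n)) =
     [:- V (int (Suc n)), 1:] * jacobi_poly V \<alpha> \<beta> (Suc n) - jacobi_poly V \<alpha> \<beta> n"

lemma poly_jacobi_poly_Suc_Suc:
  "poly (jacobi_poly V \<alpha> \<beta> (Suc (Suc n))) x =
     (x - V (int (Suc n))) * poly (jacobi_poly V \<alpha> \<beta> (Suc n)) x - poly (jacobi_poly V \<alpha> \<beta> n) x"
  by (simp add: algebra_simps)

lemma degree_linear_mult_le:
  fixes q :: "'a::comm_ring_1 poly"
  assumes "degree q \<le> n"
  shows "degree ([:c, 1:] * q) \<le> Suc n" "coeff ([:c, 1:] * q) (Suc n) = coeff q n"
proof -
  have "degree ([:c, 1:] * q) \<le> degree [:c, 1:] + degree q" by (rule degree_mult_le)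
  then show "degree ([:c, 1:] * q) \<le> Suc n" using assms by simp
  have "coeff q (Suc n) = 0" using assms by (simp add: coeff_eq_0)
  then show "coeff ([:c, 1:] * q) (Suc n) = coeff q n" by simp
qed

text \<open>Each step multiplies by a monic linear factor and subtracts a polynomial of lower
  degree, so \<beta> stays the coefficient of top order. It may be zero; that case loses one degree
  and is treated next.\<close>

lemma jacobi_poly_degree_Suc:
  "degree (jacobi_poly V \<alpha> \<beta> (Suc n)) \<le> n \<and> coeff (jacobi_poly V \<alpha> \<beta> (Suc n)) n = \<beta>"
proof (induction n rule: less_induct)
  case (less n)
  consider "n = 0" | "n = 1" | m where "n = Suc (Suc m)"
    by (metis One_nat_def not0_implies_Suc)
  then show ?case
  proof cases
    case 3
    have 1: "degree (jacobi_poly V \<alpha> \<beta> (Suc (Suc m))) \<le> Suc m"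
      "coeff (jacobi_poly V \<alpha> \<beta> (Suc (Suc m))) (Suc m) = \<beta>"
      using less[of "Suc m"] 3 by auto
    have 2: "degree (jacobi_poly V \<alpha> \<beta> (Suc m)) \<le> m" using less[of m] 3 by auto
    have 4: "coeff (jacobi_poly V \<alpha> \<beta> (Suc m)) (Suc (Suc m)) = 0" using 2 by (simp add: coeff_eq_0)
    have e: "jacobi_poly V \<alpha> \<beta> (Suc n) =
      [:- V (int (Suc (Suc m))), 1:] * jacobi_poly V \<alpha> \<beta> (Suc (Suc m)) - jacobi_poly V \<alpha> \<beta> (Suc m)"
      unfolding 3 by (rule jacobi_poly.simps)
    note d = degree_linear_mult_le[OF 1(1), of "- V (int (Suc (Suc m)))"]
    show ?thesis
      unfolding e coeff_diff
      using d 1(2) 2 4 degree_diff_le[OF d(1), of "jacobi_poly V \<alpha> \<beta> (Suc m)"] unfolding 3 by (simp del: jacobi_poly.simps)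
  qed auto
qed

text \<open>With \<open>u 1 = 0\<close> the solution effectively starts from
  \<open>u 2 = -\<alpha>\<close>, one step later. This is the boundary condition
  \<open>sin \<theta> = 0\<close>.\<close>

lemma jacobi_poly_degree_Suc_Suc:
  "degree (jacobi_poly V \<alpha> 0 (Suc (Suc n))) \<le> n \<and> coeff (jacobi_poly V \<alpha> 0 (Suc (Suc n))) n = - \<alpha>"
proof (induction n rule: less_induct)
  case (less n)
  consider "n = 0" | "n = 1" | m where "n = Suc (Suc m)"
    by (metis One_nat_def not0_implies_Suc)
  then show ?case
  proof cases
    case 3
    have 1: "degree (jacobi_poly V \<alpha> 0 (Suc (Suc (Suc m)))) \<le> Suc m"
      "coeff (jacobi_poly V \<alpha> 0 (Suc (Suc (Suc m)))) (Suc m) = - \<alpha>"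
      using less[of "Suc m"] 3 by auto
    have 2: "degree (jacobi_poly V \<alpha> 0 (Suc (Suc m))) \<le> m" using less[of m] 3 by auto
    have 4: "coeff (jacobi_poly V \<alpha> 0 (Suc (Suc m))) (Suc (Suc m)) = 0" using 2 by (intro coeff_eq_0) simp
    have e: "jacobi_poly V \<alpha> 0 (Suc (Suc n)) =
      [:- V (int (Suc (Suc (Suc m)))), 1:] * jacobi_poly V \<alpha> 0 (Suc (Suc (Suc m))) - jacobi_poly V \<alpha> 0 (Suc (Suc m))"
      unfolding 3 by (rule jacobi_poly.simps)
    note d = degree_linear_mult_le[OF 1(1), of "- V (int (Suc (Suc (Suc m))))"]
    show ?thesis
      unfolding e coeff_diff
      using d 1(2) 2 4 degree_diff_le[OF d(1), of "jacobi_poly V \<alpha> 0 (Suc (Suc m))"] unfolding 3 by (simp del: jacobi_poly.simps)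
  qed auto
qed

text \<open>At index 0 or 1 the polynomial is just \<alpha> or \<beta>, and one of these may vanish;
  from index 2 on, one of the two leading coefficients above is nonzero.\<close>

lemma jacobi_poly_nonzero:
  assumes "\<alpha> \<noteq> 0 \<or> \<beta> \<noteq> 0" "n \<ge> 2"
  shows "jacobi_poly V \<alpha> \<beta> n \<noteq> 0"
proof (cases "\<beta> = 0")
  case True
  with assms obtain k where "n = Suc (Suc k)" by (metis add_2_eq_Suc le_Suc_ex)
  with jacobi_poly_degree_Suc_Suc[of V \<alpha> k] True assms show ?thesis by (metis coeff_0 neg_equal_0_iff_equal)
next
  case False
  with assms obtain k where "n = Suc k" by (metis not_numeral_le_zero old.nat.exhaust)
  with jacobi_poly_degree_Suc[of V \<alpha> \<beta> k] False show ?thesis by (metis coeff_0)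
qed

section \<open>Transfer matrices, the discriminant and the recurrence over one period\<close>

lemma transfer_matrix_jacobi_poly:
  fixes x :: real
  shows "poly (jacobi_poly V \<alpha> \<beta> (Suc n)) x =
           transfer_matrix V x n $ 1 $ 1 * \<beta> + transfer_matrix V x n $ 1 $ 2 * \<alpha>"
    and "poly (jacobi_poly V \<alpha> \<beta> n) x =
           transfer_matrix V x n $ 2 $ 1 * \<beta> + transfer_matrix V x n $ 2 $ 2 * \<alpha>"
\<comment> \<open>Both rows share one induction: the lower row at \<open>Suc n\<close> is the upper
  row at \<open>n\<close>, and the upper row needs both.\<close>
proof (induction n)
  case (Suc n)
  show "poly (jacobi_poly V \<alpha> \<beta> (Suc (Suc n))) x =
      transfer_matrix V x (Suc n) $ 1 $ 1 * \<beta> + transfer_matrix V x (Suc n) $ 1 $ 2 * \<alpha>"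
    unfolding poly_jacobi_poly_Suc_Suc Suc
    by (simp add: matrix_matrix_mult_def sum_2 vector_2 algebra_simps)
  show "poly (jacobi_poly V \<alpha> \<beta> (Suc n)) x =
      transfer_matrix V x (Suc n) $ 2 $ 1 * \<beta> + transfer_matrix V x (Suc n) $ 2 $ 2 * \<alpha>"
    unfolding Suc by (simp add: matrix_matrix_mult_def sum_2 vector_2 algebra_simps)
qed (simp_all add: mat_def)

lemma det_transfer_matrix:
  fixes x :: real
  shows "det (transfer_matrix V x n) = 1"
proof (induction n)
  case (Suc n)
  have "det (vector [vector [x - V (int (Suc n)), - 1], vector [1, 0]] :: real^2^2) = 1"
    unfolding det_2 by simp
  then show ?case using Suc by (simp add: det_mul del: of_nat_Suc)
qed simp

text \<open>The diagonal entries of the monodromy matrix are the value at \<open>p + 1\<close> of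
  the solution with data (0, 1) and the value at \<open>p\<close> of the one with data (1,
  0).\<close>

lemma discriminant_eq_poly:
  fixes x :: real
  shows "discriminant V p x = poly (jacobi_poly V 0 1 (Suc p) + jacobi_poly V 1 0 p) x"
  by (simp add: discriminant_def trace_def sum_2 transfer_matrix_jacobi_poly[of V _ _ p] del: jacobi_poly.simps)

text \<open>A periodic potential makes the translated solution a solution again. Its initial values
  depend on \<open>x\<close>, so the identity is one of values at \<open>x\<close> and not of
  polynomials.\<close>

lemma jacobi_poly_shift:
  assumes "periodic_potential V p"
  shows "poly (jacobi_poly V \<alpha> \<beta> (n + p)) x =
    poly (jacobi_poly V (poly (jacobi_poly V \<alpha> \<beta> p) x) (poly (jacobi_poly V \<alpha> \<beta> (Suc p)) x) n) x"
proof (induction n rule: less_induct)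
  case (less n)
  consider "n = 0" | "n = 1" | m where "n = Suc (Suc m)"
    by (metis One_nat_def not0_implies_Suc)
  then show ?case
  proof cases
    case 3
    have v: "V (int (Suc (m + p))) = V (int (Suc m))"
      using assms[unfolded periodic_potential_def, rule_format, of "int (Suc m)"] by (simp add: algebra_simps)
    have e: "Suc (Suc m) + p = Suc (Suc (m + p))" by simp
    show ?thesis
      using less[of m] less[of "Suc m"] unfolding 3 e poly_jacobi_poly_Suc_Suc v by (simp del: jacobi_poly.simps)
  qed auto
qed

lemma jacobi_poly_period_recurrence:
  fixes x :: real
  assumes "periodic_potential V p"
  shows "poly (jacobi_poly V \<alpha> \<beta> (n + 2 * p)) x =
    discriminant V p x * poly (jacobi_poly V \<alpha> \<beta> (n + p)) x - poly (jacobi_poly V \<alpha> \<beta> n) x"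
proof -
  define M where "M = transfer_matrix V x p"
  define T where "T = transfer_matrix V x n"
  have det: "M $ 1 $ 1 * M $ 2 $ 2 - M $ 1 $ 2 * M $ 2 $ 1 = 1"
    using det_transfer_matrix[of V x p] by (simp add: M_def det_2)
  have D: "discriminant V p x = M $ 1 $ 1 + M $ 2 $ 2"
    by (simp add: discriminant_def trace_def sum_2 M_def)
  define w where "w = (\<lambda>n. poly (jacobi_poly V \<alpha> \<beta> n) x)"
  have w0: "w p = M $ 2 $ 1 * \<beta> + M $ 2 $ 2 * \<alpha>" "w (Suc p) = M $ 1 $ 1 * \<beta> + M $ 1 $ 2 * \<alpha>"
    unfolding w_def M_def by (rule transfer_matrix_jacobi_poly)+
  have sh: "w (k + p) = poly (jacobi_poly V (w p) (w (Suc p)) k) x" for k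
    unfolding w_def by (rule jacobi_poly_shift[OF assms])
  have w1: "w (p + p) = M $ 2 $ 1 * w (Suc p) + M $ 2 $ 2 * w p"
    "w (Suc p + p) = M $ 1 $ 1 * w (Suc p) + M $ 1 $ 2 * w p"
    unfolding sh M_def by (rule transfer_matrix_jacobi_poly)+
  have "w (n + 2 * p) = w ((n + p) + p)" by (simp add: mult_2 add.assoc)
  also have "\<dots> = poly (jacobi_poly V (w (p + p)) (w (Suc p + p)) n) x"
    by (simp only: sh jacobi_poly_shift[OF assms])
  also have "\<dots> = T $ 2 $ 1 * w (Suc p + p) + T $ 2 $ 2 * w (p + p)"
    unfolding T_def by (rule transfer_matrix_jacobi_poly)
  finally have a: "w (n + 2 * p) = T $ 2 $ 1 * w (Suc p + p) + T $ 2 $ 2 * w (p + p)" .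
  have b: "w (n + p) = T $ 2 $ 1 * w (Suc p) + T $ 2 $ 2 * w p"
    unfolding sh T_def by (rule transfer_matrix_jacobi_poly)
  have c: "w n = T $ 2 $ 1 * \<beta> + T $ 2 $ 2 * \<alpha>"
    unfolding w_def T_def by (rule transfer_matrix_jacobi_poly)
  \<comment> \<open>This and the next identity are the two rows of \<open>M^2 = D M - 1\<close>,
    Cayley-Hamilton with determinant 1, applied to the initial data. The matrix \<open>T\<close>
    then carries them to index \<open>n\<close> by linearity.\<close>
  have "w (p + p) = discriminant V p x * w p - \<alpha>"
    unfolding w1 w0 D using det by algebra
  moreover have "w (Suc p + p) = discriminant V p x * w (Suc p) - \<beta>"
    unfolding w1 w0 D using det by algebra
  ultimately have "w (n + 2 * p) = discriminant V p x * w (n + p) - w n"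
    unfolding a b c by algebra
  then show ?thesis by (simp add: w_def)
qed

section \<open>Zeros forced by sign changes\<close>

text \<open>The usual formula \<open>f m = U_(m-1) f 1 - U_(m-2) f 0\<close> with Chebyshev
  polynomials of the second kind, multiplied by \<open>sin t\<close> to avoid division. The
  subtraction \<open>real m - 1\<close> is real, so that \<open>m = 0\<close> is covered.\<close>

lemma chebyshev_recurrence:
  fixes f :: "nat \<Rightarrow> real"
  assumes "\<And>n. f (Suc (Suc n)) = 2 * cos t * f (Suc n) - f n"
  shows "sin t * f m = sin (real m * t) * f 1 - sin ((real m - 1) * t) * f 0"
proof (induction m rule: less_induct)
  case (less m)
  consider "m = 0" | "m = 1" | n where "m = Suc (Suc n)"
    by (metis One_nat_def not0_implies_Suc)
  then show ?case
  proof cases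
    case 3
    have step: "sin (s + t) = 2 * cos t * sin s - sin (s - t)" for s
      by (simp add: sin_add sin_diff)
    have "sin t * f m = 2 * cos t * (sin t * f (Suc n)) - sin t * f n"
      unfolding 3 assms by (simp add: algebra_simps)
    also have "\<dots> = (2 * cos t * sin (real (Suc n) * t) - sin (real n * t)) * f 1
        - (2 * cos t * sin ((real (Suc n) - 1) * t) - sin ((real n - 1) * t)) * f 0"
    proof -
      have n: "sin t * f n = sin (real n * t) * f 1 - sin ((real n - 1) * t) * f 0"
        and Sn: "sin t * f (Suc n) = sin (real (Suc n) * t) * f 1 - sin ((real (Suc n) - 1) * t) * f 0"
        using less[of n] less[of "Suc n"] 3 by auto
      show ?thesis unfolding n Sn by algebra
    qed
    also have "2 * cos t * sin (real (Suc n) * t) - sin (real n * t) = sin (real m * t)"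
      using step[of "real (Suc n) * t"] unfolding 3 by (simp add: algebra_simps)
    also have "2 * cos t * sin ((real (Suc n) - 1) * t) - sin ((real n - 1) * t) = sin ((real m - 1) * t)"
      using step[of "real n * t"] unfolding 3 by (simp add: algebra_simps)
    finally show ?thesis .
  qed auto
qed

text \<open>At \<open>t = k pi / m\<close> the factor \<open>sin (m t)\<close> vanishes, which
  removes \<open>f 1\<close>. The bounds on \<open>k\<close> keep \<open>sin t\<close> nonzero, so
  it can be cancelled.\<close>

lemma chebyshev_recurrence_at_node:
  fixes f :: "nat \<Rightarrow> real"
  assumes rec: "\<And>n. f (Suc (Suc n)) = D * f (Suc n) - f n"
    and D: "D = 2 * cos (pi * (real k / real m))" and k: "0 < k" "k < m"
  shows "f m = (-1) ^ k * f 0"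
proof -
  define t where "t = pi * (real k / real m)"
  have t: "0 < t" "t < pi" using k by (auto simp: t_def field_simps)
  have mt: "real m * t = real k * pi" using k by (simp add: t_def)
  have "sin t * f m = sin (real m * t) * f 1 - sin ((real m - 1) * t) * f 0"
    by (rule chebyshev_recurrence) (simp add: rec D t_def)
  also have "sin ((real m - 1) * t) = sin (real k * pi - t)" unfolding mt[symmetric] by (simp add: algebra_simps)
  also have "\<dots> = - ((-1) ^ k * sin t)" by (simp add: sin_diff cos_npi)
  finally have "sin t * f m = sin t * ((-1) ^ k * f 0)" by (simp add: mt)
  moreover have "sin t \<noteq> 0" using t sin_gt_zero by force
  ultimately show ?thesis by simp
qed

section \<open>Counting roots by sign changes between nodes\<close>

lemma card_le_of_separating:
  assumes "finite S" "\<And>k. k \<in> A \<Longrightarrow> \<exists>z\<in>S. P k z"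
    and "\<And>k l z. k \<in> A \<Longrightarrow> l \<in> A \<Longrightarrow> P k z \<Longrightarrow> P l z \<Longrightarrow> k = l"
  shows "card A \<le> card S"
proof -
  obtain h where "\<And>k. k \<in> A \<Longrightarrow> h k \<in> S \<and> P k (h k)" using assms(2) by metis
  then have h: "h ` A \<subseteq> S" "\<And>k. k \<in> A \<Longrightarrow> P k (h k)" by auto
  have "inj_on h A" by (rule inj_onI) (metis assms(3) h(2))
  then show ?thesis using h(1) assms(1) by (rule card_inj_on_le)
qed

text \<open>Half-open intervals on opposite sides make the count work even when \<open>F\<close> and \<open>G\<close> vanish together
  at a node: such a zero is charged to \<open>F\<close> on its left and to \<open>G\<close> on its right.\<close>

lemma card_roots_of_alternation:
  fixes F G :: "real poly" and y :: "nat \<Rightarrow> real"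
  assumes nz: "F \<noteq> 0" "G \<noteq> 0" and "\<sigma> \<noteq> 0"
    and y: "strict_mono_on {k0..k1} y"
    and alt: "\<And>k. k \<in> {k0..k1} \<Longrightarrow> poly F (y k) = \<sigma> * (-1) ^ k * poly G (y k)"
  shows "k1 - k0 \<le> card {x. poly G x = 0} + card {x. y k0 < x \<and> x \<le> y k1 \<and> poly F x = 0}"
proof -
  define A where "A = {k\<in>{k0..<k1}. \<exists>z. poly G z = 0 \<and> y k \<le> z \<and> z < y (Suc k)}"
  define B where "B = {k\<in>{k0..<k1}. \<exists>z. poly F z = 0 \<and> y k < z \<and> z \<le> y (Suc k)}"
  have mono: "y k \<le> y l" if "k0 \<le> k" "k \<le> l" "l \<le> k1" for k l
    using that strict_mono_on_leD[OF y] by simp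
  \<comment> \<open>The nodes increase, so two different cells meet at most in an endpoint;
    half-open cells are disjoint.\<close>
  have sep: "k = l" if "k \<in> {k0..<k1}" "l \<in> {k0..<k1}" "\<not> y (Suc k) \<le> y l" "\<not> y (Suc l) \<le> y k" for k l
    using that mono[of "Suc k" l] mono[of "Suc l" k] by (metis Suc_leI atLeastLessThan_iff le_Suc_eq less_imp_le linorder_neqE_nat)
  have "k \<in> A \<union> B" if k: "k \<in> {k0..<k1}" for k
  proof (rule ccontr)
    assume "k \<notin> A \<union> B"
    then have nA: "\<And>z. y k \<le> z \<Longrightarrow> z < y (Suc k) \<Longrightarrow> poly G z \<noteq> 0"
      and nB: "\<And>z. y k < z \<Longrightarrow> z \<le> y (Suc k) \<Longrightarrow> poly F z \<noteq> 0"
      using k by (auto simp: A_def B_def)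
    have lt: "y k < y (Suc k)" using k strict_mono_onD[OF y, of k "Suc k"] by simp
    have e: "poly F (y k) = \<sigma> * (-1) ^ k * poly G (y k)"
      "poly F (y (Suc k)) = - (\<sigma> * (-1) ^ k * poly G (y (Suc k)))"
      using alt[of k] alt[of "Suc k"] k by auto
    \<comment> \<open>Nonvanishing of \<open>G\<close> at the left node is assumed directly; at the
      right node only \<open>F\<close> is known not to vanish, and the alternation transfers this to
      \<open>G\<close>.\<close>
    have G0: "poly G (y k) \<noteq> 0" "poly G (y (Suc k)) \<noteq> 0"
      using nA[of "y k"] nB[of "y (Suc k)"] lt e by auto
    have Gp: "poly G (y k) * poly G (y (Suc k)) > 0"
      using poly_IVT[OF lt, of G] nA G0 by (metis less_imp_le linorder_neqE_linordered_idom mult_eq_0_iff)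
    \<comment> \<open>\<open>G\<close> has no zero in the cell and keeps its sign, while the factor
      \<open>(-1) ^ k\<close> flips, so \<open>F\<close> changes sign and must have a zero
      there.\<close>
    have "poly F (y k) * poly F (y (Suc k)) = - ((\<sigma> * (-1) ^ k)\<^sup>2 * (poly G (y k) * poly G (y (Suc k))))"
      unfolding e by (simp add: power2_eq_square algebra_simps)
    also have "\<dots> < 0" using Gp \<open>\<sigma> \<noteq> 0\<close> by (simp add: power_mult_distrib)
    finally show False using poly_IVT[OF lt, of F] nB by (metis less_imp_le)
  qed
  then have "{k0..<k1} = A \<union> B" by (fastforce simp only: A_def B_def)
  then have "k1 - k0 \<le> card A + card B" by (metis card_Un_le card_atLeastLessThan)
  moreover have "card A \<le> card {x. poly G x = 0}"
  proof (rule card_le_of_separating[where P = "\<lambda>k z. y k \<le> z \<and> z < y (Suc k)"])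
    show "finite {x. poly G x = 0}" by (rule poly_roots_finite[OF nz(2)])
    show "\<exists>z\<in>{x. poly G x = 0}. y k \<le> z \<and> z < y (Suc k)" if "k \<in> A" for k
      using that unfolding A_def by auto
    show "k = l" if "k \<in> A" "l \<in> A" "y k \<le> z \<and> z < y (Suc k)" "y l \<le> z \<and> z < y (Suc l)" for k l z
      using that sep[of k l] unfolding A_def by auto
  qed
  moreover have "card B \<le> card {x. y k0 < x \<and> x \<le> y k1 \<and> poly F x = 0}"
  proof (rule card_le_of_separating[where P = "\<lambda>k z. y k < z \<and> z \<le> y (Suc k)"])
    show "finite {x. y k0 < x \<and> x \<le> y k1 \<and> poly F x = 0}"
      by (rule finite_subset[OF _ poly_roots_finite[OF nz(1)]]) auto
    show "\<exists>z\<in>{x. y k0 < x \<and> x \<le> y k1 \<and> poly F x = 0}. y k < z \<and> z \<le> y (Suc k)" if k: "k \<in> B" for k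
      using k mono[of k0 k] mono[of "Suc k" k1] unfolding B_def by fastforce
    show "k = l" if "k \<in> B" "l \<in> B" "y k < z \<and> z \<le> y (Suc k)" "y l < z \<and> z \<le> y (Suc l)" for k l z
      using that sep[of k l] unfolding B_def by auto
  qed
  ultimately show ?thesis by linarith
qed

text \<open>The nodes are the points where \<omega> equals \<open>k / m\<close>; about
  \<open>m * (\<omega> d - \<omega> c)\<close> of them lie between \<open>c\<close> and
  \<open>d\<close>. Rounding costs at most 2, and the zeros of \<open>G\<close> account for cells in
  which \<open>F\<close> need not vanish.\<close>

lemma card_roots_in_band:
  fixes F G :: "real poly" and \<omega> :: "real \<Rightarrow> real"
  assumes nz: "F \<noteq> 0" "G \<noteq> 0" and \<sigma>: "\<sigma> \<noteq> 0"
    and mono: "strict_mono_on {a..b} \<omega>" and img: "\<omega> ` {a..b} = {0..1}"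
    and alt: "\<And>k x. \<lbrakk>0 < k; k < m; x \<in> {a..b}; \<omega> x = real k / real m\<rbrakk> \<Longrightarrow>
                poly F x = \<sigma> * (-1) ^ k * poly G x"
    and cd: "a \<le> c" "c \<le> d" "d \<le> b"
  shows "real m * (\<omega> d - \<omega> c) - 2 - real (card {x. poly G x = 0})
           \<le> real (card {x. c < x \<and> x < d \<and> poly F x = 0})"
proof (cases "m = 0")
  case False
  \<comment> \<open>\<open>k0\<close> is the least integer above \<open>m * \<omega> c\<close> and
    \<open>k1\<close> the greatest below \<open>m * \<omega> d\<close>. Strictness puts the nodes
    inside the open interval and gives \<open>0 < k < m\<close>, as the alternation
    requires.\<close>
  define k0 where "k0 = \<lfloor>real m * \<omega> c\<rfloor> + 1"
  define k1 where "k1 = \<lceil>real m * \<omega> d\<rceil> - 1"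
  have oc: "0 \<le> \<omega> c" "\<omega> d \<le> 1" using img cd by (auto simp: set_eq_iff image_iff) (metis cd atLeastAtMost_iff order_trans)+
  have k0: "k0 \<ge> 1" using oc by (simp add: k0_def)
  have k1: "k1 < int m"
  proof -
    have "real m * \<omega> d \<le> real m" using oc by (simp add: mult_left_le)
    then have "\<lceil>real m * \<omega> d\<rceil> \<le> int m" by (simp add: ceiling_le_iff)
    then show ?thesis by (simp add: k1_def)
  qed
  have diff: "real m * (\<omega> d - \<omega> c) - 2 \<le> of_int (k1 - k0)"
    unfolding k0_def k1_def by (simp add: algebra_simps) linarith
  show ?thesis
  proof (cases "k0 \<le> k1")
    case True
    \<comment> \<open>Node \<open>k\<close> is the preimage of \<open>k / m\<close> under \<omega>;
      it is meaningful only for \<open>k \<le> m\<close>.\<close>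
    define y where "y = (\<lambda>k::nat. SOME x. x \<in> {a..b} \<and> \<omega> x = real k / real m)"
    have y: "y k \<in> {a..b} \<and> \<omega> (y k) = real k / real m" if "k \<le> m" for k
    proof -
      have "real k / real m \<in> {0..1}" using that False by simp
      then have "\<exists>x. x \<in> {a..b} \<and> \<omega> x = real k / real m" using img by (metis (no_types, lifting) imageE)
      then show ?thesis unfolding y_def by (rule someI_ex)
    qed
    have less_iff: "x < x' \<longleftrightarrow> \<omega> x < \<omega> x'" if "x \<in> {a..b}" "x' \<in> {a..b}" for x x'
      using that strict_mono_on_less[OF mono] by simp
    have ym: "strict_mono_on {nat k0..nat k1} y"
    proof (rule strict_mono_onI)
      fix r s assume "r \<in> {nat k0..nat k1}" "s \<in> {nat k0..nat k1}" "r < s"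
      then have "r \<le> m" "s \<le> m" using k1 by auto
      then show "y r < y s" using y[of r] y[of s] less_iff[of "y r" "y s"] \<open>r < s\<close> False
        by (simp add: divide_strict_right_mono)
    qed
    have "nat k1 - nat k0 \<le> card {x. poly G x = 0} + card {x. y (nat k0) < x \<and> x \<le> y (nat k1) \<and> poly F x = 0}"
    proof (rule card_roots_of_alternation[OF nz \<sigma> ym])
      fix k assume "k \<in> {nat k0..nat k1}"
      then have "0 < k" "k < m" using k0 k1 by auto
      then show "poly F (y k) = \<sigma> * (-1) ^ k * poly G (y k)" using alt[of k "y k"] y[of k] by simp
    qed
    moreover have "c < y (nat k0)"
    proof -
      have "real m * \<omega> c < real (nat k0)" using k0 k0_def by linarith
      then have "\<omega> c < real (nat k0) / real m" using False by (simp add: field_simps)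
      then show ?thesis using less_iff[of c "y (nat k0)"] y[of "nat k0"] True k1 cd by simp
    qed
    moreover have "y (nat k1) < d"
    proof -
      have "real (nat k1) < real m * \<omega> d" using k0 True k1_def by linarith
      then have "real (nat k1) / real m < \<omega> d" using False by (simp add: field_simps)
      then show ?thesis using less_iff[of "y (nat k1)" d] y[of "nat k1"] True k1 cd by simp
    qed
    moreover have "card {x. y (nat k0) < x \<and> x \<le> y (nat k1) \<and> poly F x = 0}
        \<le> card {x. c < x \<and> x < d \<and> poly F x = 0}"
      if "c < y (nat k0)" "y (nat k1) < d"
    proof (rule card_mono)
      show "finite {x. c < x \<and> x < d \<and> poly F x = 0}"
        by (rule finite_subset[OF _ poly_roots_finite[OF nz(1)]]) auto
    qed (use that in auto)
    ultimately have "nat k1 - nat k0 \<le> card {x. poly G x = 0} + card {x. c < x \<and> x < d \<and> poly F x = 0}"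
      by linarith
    then have "k1 - k0 \<le> int (card {x. poly G x = 0}) + int (card {x. c < x \<and> x < d \<and> poly F x = 0})"
      using True k0 by linarith
    then have "of_int (k1 - k0) \<le> real (card {x. poly G x = 0}) + real (card {x. c < x \<and> x < d \<and> poly F x = 0})"
      by linarith
    then show ?thesis using diff by linarith
  next
    \<comment> \<open>With no node in the interval the claimed lower bound is not positive.\<close>
    case False
    then have "of_int (k1 - k0) \<le> (0::real)" by simp
    then show ?thesis using diff by linarith
  qed
qed simp

section \<open>Eigenvalues of the restricted operator\<close>

text \<open>The left condition makes \<open>(u 0, u 1)\<close> a multiple of
  \<open>(cos \<theta>, sin \<theta>)\<close>, so an eigenvector is a multiple of the polynomial
  solution on \<open>0..L\<close>, and only the condition at \<open>L\<close> remains.\<close>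

lemma of_real_mem_restricted_spectrum_iff:
  assumes L: "L \<ge> 2"
  shows "complex_of_real x \<in> restricted_spectrum V \<theta> L \<longleftrightarrow>
           poly (jacobi_poly V (cos \<theta>) (sin \<theta>) L) x = 0"
proof
  define w where "w = (\<lambda>n. poly (jacobi_poly V (cos \<theta>) (sin \<theta>) n) x)"
  have w: "w 0 = cos \<theta>" "w (Suc 0) = sin \<theta>"
    and w_rec: "w (Suc (Suc n)) = (x - V (int (Suc n))) * w (Suc n) - w n" for n
    unfolding w_def poly_jacobi_poly_Suc_Suc by simp_all
  {
    assume "complex_of_real x \<in> restricted_spectrum V \<theta> L"
    then obtain u where u: "\<exists>n\<in>{1..int L - 1}. u n \<noteq> 0"
      "u 0 * of_real (sin \<theta>) = u 1 * of_real (cos \<theta>)" "u (int L) = 0"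
      "\<And>n. n \<in> {1..int L - 1} \<Longrightarrow> jacobi V u n = of_real x * u n"
      unfolding restricted_spectrum_def by blast
    \<comment> \<open>The multiple is found as the inner product of \<open>(u 0, u 1)\<close> with
      the unit vector \<open>(cos \<theta>, sin \<theta>)\<close>.\<close>
    define \<gamma> where "\<gamma> = u 0 * of_real (cos \<theta>) + u 1 * of_real (sin \<theta>)"
    have sc: "complex_of_real (sin \<theta>) * of_real (sin \<theta>) + of_real (cos \<theta>) * of_real (cos \<theta>) = 1"
      using sin_cos_squared_add3[of \<theta>] by (metis add.commute of_real_1 of_real_add of_real_mult)
    have u0: "u 0 = \<gamma> * of_real (cos \<theta>)" and u1: "u 1 = \<gamma> * of_real (sin \<theta>)"
      using u(2) sc unfolding \<gamma>_def by algebra+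
    have un: "n \<le> L \<Longrightarrow> u (int n) = \<gamma> * of_real (w n)" for n
    proof (induction n rule: less_induct)
      case (less n)
      consider "n = 0" | "n = 1" | m where "n = Suc (Suc m)"
        by (metis One_nat_def not0_implies_Suc)
      then show ?case
      proof cases
        case 3
        have "jacobi V u (int (Suc m)) = of_real x * u (int (Suc m))"
          using less.prems 3 by (intro u(4)) auto
        then have "u (int n) = (of_real x - of_real (V (int (Suc m)))) * u (int (Suc m)) - u (int m)"
          by (simp add: jacobi_def 3 algebra_simps)
        then show ?thesis
          using less.IH[of m] less.IH[of "Suc m"] less.prems unfolding 3 w_rec
          by (simp add: algebra_simps)
      qed (use u0 u1 w in auto)
    qed
    obtain n where "n \<in> {1..int L - 1}" "u n \<noteq> 0" using u(1) by blast
    then have "\<gamma> \<noteq> 0" using un[of "nat n"] by auto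
    then show "poly (jacobi_poly V (cos \<theta>) (sin \<theta>) L) x = 0"
      using un[of L] u(3) by (simp add: w_def)
  next
    assume "poly (jacobi_poly V (cos \<theta>) (sin \<theta>) L) x = 0"
    then have wL: "w L = 0" by (simp add: w_def)
    define u where "u = (\<lambda>n. complex_of_real (w (nat n)))"
    have "\<exists>n\<in>{1..int L - 1}. u n \<noteq> 0"
    proof (rule ccontr)
      assume "\<not> ?thesis"
      \<comment> \<open>Including \<open>n = L\<close> matters for \<open>L = 2\<close>: the
        vanishing of \<open>w 1\<close> and \<open>w 2\<close> then forces \<open>w 0 = 0\<close>
        through the recurrence, against \<open>(w 0, w 1)\<close> being a unit vector.\<close>
      then have z: "w n = 0" if "1 \<le> n" "n \<le> L" for n
        using that wL by (cases "n = L") (force simp: u_def dest!: bspec[of _ _ "int n"])+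
      have "w 1 = 0" "w 2 = 0" using z L by auto
      then have "sin \<theta> = 0" "cos \<theta> = 0" using w w_rec[of 0] by (auto simp: numeral_2_eq_2)
      then show False using sin_cos_squared_add3[of \<theta>] by simp
    qed
    moreover have "jacobi V u n = of_real x * u n" if n: "n \<in> {1..int L - 1}" for n
    proof -
      define m where "m = nat (n - 1)"
      have n: "n = int (Suc m)" using n by (simp add: m_def)
      have "n + 1 = int (Suc (Suc m))" "n - 1 = int m" by (simp_all add: n)
      then have u': "u n = of_real (w (Suc m))" "u (n + 1) = of_real (w (Suc (Suc m)))" "u (n - 1) = of_real (w m)"
        unfolding u_def by (simp_all only: n nat_int)
      show ?thesis unfolding jacobi_def u' w_rec n[symmetric] by (simp add: algebra_simps)
    qed
    moreover have "u 0 * of_real (sin \<theta>) = u 1 * of_real (cos \<theta>)" "u (int L) = 0"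
      by (simp_all add: u_def w wL)
    ultimately show "complex_of_real x \<in> restricted_spectrum V \<theta> L"
      unfolding restricted_spectrum_def by blast
  }
qed

lemma ids_restricted_eq:
  assumes "L \<ge> 2"
  shows "ids_restricted V \<theta> L E =
    real (card {x. x \<le> E \<and> poly (jacobi_poly V (cos \<theta>) (sin \<theta>) L) x = 0}) / (real L - 1)"
  by (simp add: ids_restricted_def of_real_mem_restricted_spectrum_iff[OF assms] conj_commute)

section \<open>Orientation of the bands\<close>

definition discriminant_poly :: "(int \<Rightarrow> real) \<Rightarrow> nat \<Rightarrow> real poly" where
  "discriminant_poly V p = jacobi_poly V 0 1 (Suc p) + jacobi_poly V 1 0 p"

lemma poly_discriminant_poly: "poly (discriminant_poly V p) = discriminant V p"
  by (rule ext) (simp add: discriminant_poly_def discriminant_eq_poly)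

lemma discriminant_poly_monic:
  assumes "p \<ge> 1"
  shows "degree (discriminant_poly V p) = p" "lead_coeff (discriminant_poly V p) = 1"
proof -
  obtain q where p: "p = Suc q" using assms by (metis Suc_le_D One_nat_def)
  have 1: "degree (jacobi_poly V 0 1 (Suc p)) \<le> p" "coeff (jacobi_poly V 0 1 (Suc p)) p = 1"
    using jacobi_poly_degree_Suc[of V 0 1 p] by auto
  have 2: "degree (jacobi_poly V 1 0 p) < p"
    using jacobi_poly_degree_Suc[of V 1 0 q] by (simp add: p)
  have 3: "coeff (discriminant_poly V p) p = 1"
    unfolding discriminant_poly_def coeff_add using 1(2) 2 by (simp add: coeff_eq_0)
  have "degree (discriminant_poly V p) \<le> p"
    unfolding discriminant_poly_def using 1 2 by (intro degree_add_le) auto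
  then show "degree (discriminant_poly V p) = p" using 3 by (metis le_antisym le_degree zero_neq_one)
  then show "lead_coeff (discriminant_poly V p) = 1" using 3 by simp
qed

text \<open>The extreme values are attained somewhere, and monotonicity moves them to the
  endpoints.\<close>

lemma mono_bij_betw_endpoints:
  fixes f :: "real \<Rightarrow> real"
  assumes "bij_betw f {a..b} {c..d}" "mono_on {a..b} f" "a \<le> b" "c \<le> d"
  shows "f a = c" "f b = d"
proof -
  have "c \<in> f ` {a..b}" "d \<in> f ` {a..b}" using assms by (auto simp: bij_betw_def)
  then obtain x y where "x \<in> {a..b}" "f x = c" "y \<in> {a..b}" "f y = d" by auto
  moreover have "f a \<in> {c..d}" "f b \<in> {c..d}" using assms(1,3) by (auto simp: bij_betw_def)
  ultimately show "f a = c" "f b = d"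
    using mono_onD[OF assms(2), of a x] mono_onD[OF assms(2), of y b] assms(3) by auto
qed

lemma spectral_bands_le:
  assumes "spectral_bands V p a b" "1 \<le> i" "i < j" "j \<le> p"
  shows "b i \<le> a j"
  using assms(3,4)
proof (induction j rule: less_induct)
  case (less j)
  have ab: "\<And>j. j \<in> {1..p} \<Longrightarrow> a j < b j" "\<And>j. j \<in> {1..<p} \<Longrightarrow> b j \<le> a (j + 1)"
    using assms(1) by (auto simp: spectral_bands_def)
  obtain k where k: "j = Suc k" using less.prems by (cases j) auto
  show ?case
  proof (cases "k = i")
    case True
    then show ?thesis using ab(2)[of i] less.prems assms(2) k by simp
  next
    case False
    then show ?thesis using less.IH[of k] ab(1)[of k] ab(2)[of k] less.prems assms(2) k by simp
  qed
qed

lemma discriminant_in_band: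
  assumes "spectral_bands V p a b" "j \<in> {1..p}" "x \<in> {a j..b j}"
  shows "discriminant V p x \<in> {-2..2}"
proof -
  have "bij_betw (discriminant V p) {a j..b j} {-2..2}"
    using assms by (auto simp: spectral_bands_def)
  then show ?thesis using assms(3) by (rule bij_betwE[rule_format])
qed

text \<open>The decreasing case reduces to the increasing one by passing to the negative of the
  discriminant.\<close>

lemma discriminant_band_endpoints:
  assumes bands: "spectral_bands V p a b" and j: "j \<in> {1..p}"
  shows "mono_on {a j..b j} (discriminant V p) \<and>
           discriminant V p (a j) = -2 \<and> discriminant V p (b j) = 2 \<or>
         antimono_on {a j..b j} (discriminant V p) \<and>
           discriminant V p (a j) = 2 \<and> discriminant V p (b j) = -2"
proof -
  have ab: "a j < b j" and bij: "bij_betw (discriminant V p) {a j..b j} {-2..2}"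
    and mono: "mono_on {a j..b j} (discriminant V p) \<or> antimono_on {a j..b j} (discriminant V p)"
    using bands j by (auto simp: spectral_bands_def)
  from mono show ?thesis
  proof
    assume m: "mono_on {a j..b j} (discriminant V p)"
    show ?thesis using mono_bij_betw_endpoints[OF bij m] m ab by simp
  next
    assume m: "antimono_on {a j..b j} (discriminant V p)"
    have "bij_betw uminus {-2..2::real} {-2..2}"
      by (rule bij_betw_byWitness[where f' = uminus]) auto
    from bij_betw_trans[OF bij this]
    have bij': "bij_betw (\<lambda>x. - discriminant V p x) {a j..b j} {-2..2}" by (simp add: o_def)
    have m': "mono_on {a j..b j} (\<lambda>x. - discriminant V p x)" using m by (simp add: monotone_on_def)
    have "- discriminant V p (a j) = -2" "- discriminant V p (b j) = 2"
      using mono_bij_betw_endpoints[OF bij' m'] ab by simp_all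
    then show ?thesis using m by simp
  qed
qed

text \<open>Each band already contains one of the at most \<open>p\<close> zeros of \<open>D\<close>.\<close>

lemma discriminant_zero_in_band:
  assumes p: "p \<ge> 1" and bands: "spectral_bands V p a b" and x: "discriminant V p x = 0"
  shows "\<exists>j\<in>{1..p}. a j < x \<and> x < b j"
proof (rule ccontr)
  assume no: "\<not> ?thesis"
  let ?P = "discriminant_poly V p"
  have "\<exists>z. z \<in> {a j..b j} \<and> discriminant V p z = 0" if "j \<in> {1..p}" for j
  proof -
    have "0 \<in> discriminant V p ` {a j..b j}"
      using bands that by (auto simp: spectral_bands_def bij_betw_def)
    then show ?thesis by auto
  qed
  then obtain z where z: "\<And>j. j \<in> {1..p} \<Longrightarrow> z j \<in> {a j..b j} \<and> discriminant V p (z j) = 0" by metis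
  \<comment> \<open>At band ends the discriminant is 2 or -2, so its zero is interior; hence even
    touching bands have different zeros.\<close>
  have z': "a j < z j \<and> z j < b j" if "j \<in> {1..p}" for j
    using z[OF that] discriminant_band_endpoints[OF bands that] by (auto simp: less_le)
  have lt: "z i < z j" if "i \<in> {1..p}" "j \<in> {1..p}" "i < j" for i j
    using z'[OF that(1)] z'[OF that(2)] spectral_bands_le[OF bands, of i j] that by simp
  have "inj_on z {1..p}"
    using lt by (intro inj_onI) (metis less_irrefl linorder_neqE_nat)
  moreover have "x \<notin> z ` {1..p}" using no z' by auto
  ultimately have "card (insert x (z ` {1..p})) = Suc p" by (simp add: card_image)
  moreover have "insert x (z ` {1..p}) \<subseteq> {x. poly ?P x = 0}"
    using z x by (auto simp: poly_discriminant_poly)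
  moreover have "?P \<noteq> 0" using discriminant_poly_monic[OF p, of V] by auto
  ultimately have "Suc p \<le> card {x. poly ?P x = 0}" by (metis card_mono poly_roots_finite)
  also have "\<dots> \<le> p" using card_poly_roots_bound[OF \<open>?P \<noteq> 0\<close>] discriminant_poly_monic[OF p, of V] by simp
  finally show False by simp
qed

text \<open>Downward induction from the last band. The discriminant is positive far to the right and
  has no zero outside the bands, so it equals 2 at \<open>b p\<close>; it keeps its value from one
  end of a gap to the other and changes sign across each band.\<close>

lemma discriminant_at_band_end:
  assumes p: "p \<ge> 1" and bands: "spectral_bands V p a b" and j: "1 \<le> j" "j \<le> p"
  shows "discriminant V p (b j) = (if even (p - j) then 2 else -2)"
  using j(2,1)
proof (induction rule: inc_induct)
  case base
  obtain n where "\<forall>x\<ge>n. poly (discriminant_poly V p) x \<ge> 1"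
    using poly_pinfty_gt_lc[of "discriminant_poly V p"] discriminant_poly_monic(2)[OF p, of V] by auto
  then have n: "discriminant V p x \<ge> 1" if "x \<ge> n" for x
    using that by (simp add: poly_discriminant_poly)
  define y where "y = max n (b p + 1)"
  have y: "discriminant V p y \<ge> 1" "b p < y" using n[of y] by (auto simp: y_def)
  have "discriminant V p (b p) \<noteq> -2"
  proof
    assume "discriminant V p (b p) = -2"
    then obtain x where x: "b p < x" "discriminant V p x = 0"
      using poly_IVT_pos[OF y(2), of "discriminant_poly V p"] y(1) by (auto simp: poly_discriminant_poly)
    then obtain i where i: "i \<in> {1..p}" "x < b i"
      using discriminant_zero_in_band[OF p bands] by blast
    then have "i < p" using x by (cases "i = p") auto
    then have "b i \<le> a p" "a p < b p"
      using spectral_bands_le[OF bands, of i p] i bands p by (auto simp: spectral_bands_def)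
    then show False using i x by simp
  qed
  then show ?case using discriminant_band_endpoints[OF bands, of p] p by auto
next
  case (step j)
  have j: "j \<in> {1..p}" "Suc j \<in> {1..p}" using step by auto
  have le: "b j \<le> a (Suc j)" using spectral_bands_le[OF bands, of j "Suc j"] j by simp
  \<comment> \<open>Both values are 2 or -2; if they differed, there would be a zero strictly inside
    the gap.\<close>
  have "discriminant V p (b j) = discriminant V p (a (Suc j))"
  proof (rule ccontr)
    assume ne: "discriminant V p (b j) \<noteq> discriminant V p (a (Suc j))"
    then have lt: "b j < a (Suc j)" using le by (cases "b j = a (Suc j)") auto
    have "discriminant V p (b j) * discriminant V p (a (Suc j)) < 0"
      using ne discriminant_band_endpoints[OF bands j(1)] discriminant_band_endpoints[OF bands j(2)] by auto
    then obtain x where x: "b j < x" "x < a (Suc j)" "discriminant V p x = 0"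
      using poly_IVT[OF lt, of "discriminant_poly V p"] by (auto simp: poly_discriminant_poly)
    then obtain i where i: "i \<in> {1..p}" "a i < x" "x < b i"
      using discriminant_zero_in_band[OF p bands] by blast
    have ab: "a k < b k" if "k \<in> {1..p}" for k using bands that by (auto simp: spectral_bands_def)
    consider "i < j" | "i = j" | "i = Suc j" | "i > Suc j" by linarith
    then show False
      using spectral_bands_le[OF bands, of i j] spectral_bands_le[OF bands, of "Suc j" i] ab[OF j(1)] ab[OF j(2)] i j x
      by cases auto
  qed
  moreover have "even (p - j) \<longleftrightarrow> odd (p - Suc j)" using step by (simp add: Suc_diff_Suc[symmetric])
  ultimately show ?case
    using step discriminant_band_endpoints[OF bands j(2)] by auto
qed

text \<open>The value at the right end decides the direction, and injectivity on the band makes the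
  monotonicity strict.\<close>

lemma discriminant_band_orientation:
  assumes p: "p \<ge> 1" and bands: "spectral_bands V p a b" and j: "j \<in> {1..p}"
  shows "even (p - j) \<Longrightarrow> strict_mono_on {a j..b j} (discriminant V p)"
    and "odd (p - j) \<Longrightarrow> strict_antimono_on {a j..b j} (discriminant V p)"
proof -
  have "inj_on (discriminant V p) {a j..b j}"
    using bands j by (auto simp: spectral_bands_def bij_betw_def)
  then show "even (p - j) \<Longrightarrow> strict_mono_on {a j..b j} (discriminant V p)"
    and "odd (p - j) \<Longrightarrow> strict_antimono_on {a j..b j} (discriminant V p)"
    using discriminant_band_endpoints[OF bands j] discriminant_at_band_end[OF p bands, of j] j
    by (auto simp: strict_mono_iff_mono strict_antimono_iff_antimono)
qed

section \<open>Counting states\<close>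

text \<open>The normalised Bloch phase, oriented to increase from 0 to 1 along the band:
  \<open>arccos\<close> is decreasing, so it is reflected exactly where the discriminant
  increases.\<close>

definition band_fraction :: "(int \<Rightarrow> real) \<Rightarrow> nat \<Rightarrow> nat \<Rightarrow> real \<Rightarrow> real" where
  "band_fraction V p j x =
     (if even (p - j) then 1 - arccos (discriminant V p x / 2) / pi else arccos (discriminant V p x / 2) / pi)"

lemma strict_mono_on_band_fraction:
  assumes "p \<ge> 1" and bands: "spectral_bands V p a b" and j: "j \<in> {1..p}"
  shows "strict_mono_on {a j..b j} (band_fraction V p j)"
proof (rule strict_mono_onI)
  fix x y assume xy: "x \<in> {a j..b j}" "y \<in> {a j..b j}" "x < y"
  have D: "\<bar>discriminant V p z / 2\<bar> \<le> 1" if "z \<in> {a j..b j}" for z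
    using discriminant_in_band[OF bands j that] by (auto simp: abs_le_iff)
  note less = arccos_less_mono[OF D[OF xy(1)] D[OF xy(2)]] arccos_less_mono[OF D[OF xy(2)] D[OF xy(1)]]
  show "band_fraction V p j x < band_fraction V p j y"
  proof (cases "even (p - j)")
    case True
    have "discriminant V p x < discriminant V p y"
      using strict_mono_onD[OF discriminant_band_orientation(1)[OF assms True] xy] .
    then show ?thesis using True less by (simp add: band_fraction_def divide_strict_right_mono)
  next
    case False
    then have "discriminant V p y < discriminant V p x"
      using discriminant_band_orientation(2)[OF assms] xy by (auto simp: monotone_on_def)
    then show ?thesis using False less by (simp add: band_fraction_def divide_strict_right_mono)
  qed
qed

lemma band_fraction_image:
  assumes bands: "spectral_bands V p a b" and j: "j \<in> {1..p}"
  shows "band_fraction V p j ` {a j..b j} = {0..1}"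
proof -
  have img: "discriminant V p ` {a j..b j} = {-2..2}"
    using bands j by (auto simp: spectral_bands_def bij_betw_def)
  define h where "h = (\<lambda>d. if even (p - j) then 1 - arccos (d / 2) / pi else arccos (d / 2) / pi)"
  have "h d \<in> {0..1}" if "d \<in> {-2..2}" for d
    using that arccos_lbound[of "d / 2"] arccos_ubound[of "d / 2"] by (auto simp: h_def)
  moreover have "\<exists>d\<in>{-2..2}. s = h d" if s: "s \<in> {0..1}" for s
  proof (intro bexI)
    \<comment> \<open>Obtained by solving \<open>s = h (2 * cos t)\<close> for the angle.\<close>
    define t where "t = pi * (if even (p - j) then 1 - s else s)"
    have "0 \<le> t" "t \<le> pi" using s by (auto simp: t_def mult_left_le)
    then have "arccos (cos t) = t" by (rule arccos_cos)
    then show "s = h (2 * cos t)" by (auto simp: h_def t_def)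
    show "2 * cos t \<in> {-2..2}" using cos_le_one[of t] cos_ge_minus_one[of t] by simp
  qed
  ultimately have "h ` {-2..2} = {0..1}" by (auto simp: image_iff)
  moreover have "band_fraction V p j = h \<circ> discriminant V p" by (auto simp: band_fraction_def h_def)
  ultimately show ?thesis by (metis image_comp img)
qed

lemma discriminant_eq_cos_band_fraction:
  assumes bands: "spectral_bands V p a b" and j: "j \<in> {1..p}" and x: "x \<in> {a j..b j}"
  shows "discriminant V p x =
    2 * cos (pi * (if even (p - j) then 1 - band_fraction V p j x else band_fraction V p j x))"
  using discriminant_in_band[OF assms] by (simp add: band_fraction_def)

text \<open>The node count for \<open>F = Q (m p + r)\<close> and \<open>G = Q r\<close>. Taking
  \<open>r\<close> from 2 to \<open>p + 1\<close> covers all residues and keeps \<open>Q r\<close>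
  nonzero; the error does not depend on \<open>m\<close>.\<close>

lemma card_jacobi_poly_roots_in_band:
  fixes \<theta> :: real
  assumes p: "p \<ge> 1" and per: "periodic_potential V p" and bands: "spectral_bands V p a b"
    and j: "j \<in> {1..p}" and r: "2 \<le> r" "r \<le> Suc p" and cd: "a j \<le> c" "c \<le> d" "d \<le> b j"
  shows "real m * (band_fraction V p j d - band_fraction V p j c) - (2 + real p)
    \<le> real (card {x. c < x \<and> x < d \<and> poly (jacobi_poly V (cos \<theta>) (sin \<theta>) (m * p + r)) x = 0})"
proof -
  define Q where "Q = jacobi_poly V (cos \<theta>) (sin \<theta>)"
  have "cos \<theta> \<noteq> 0 \<or> sin \<theta> \<noteq> 0" using cos_one_sin_zero sin_zero_abs_cos_one by fastforce
  then have nz: "Q n \<noteq> 0" if "n \<ge> 2" for n unfolding Q_def using that by (rule jacobi_poly_nonzero)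
  \<comment> \<open>In an increasing band the node \<open>k / m\<close> has angle
    \<open>(m - k) pi / m\<close>, which costs the additional sign \<open>(-1) ^ m\<close>.\<close>
  define \<sigma> :: real where "\<sigma> = (if even (p - j) then (-1) ^ m else 1)"
  have "real m * (band_fraction V p j d - band_fraction V p j c) - 2 - real (card {x. poly (Q r) x = 0})
    \<le> real (card {x. c < x \<and> x < d \<and> poly (Q (m * p + r)) x = 0})"
  proof (rule card_roots_in_band)
    show "strict_mono_on {a j..b j} (band_fraction V p j)" by (rule strict_mono_on_band_fraction[OF p bands j])
    show "band_fraction V p j ` {a j..b j} = {0..1}" by (rule band_fraction_image[OF bands j])
    show "\<sigma> \<noteq> 0" by (simp add: \<sigma>_def)
    fix k x assume k: "0 < k" "k < m" and x: "x \<in> {a j..b j}" "band_fraction V p j x = real k / real m"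
    have rec: "poly (Q (Suc (Suc n) * p + r)) x =
        discriminant V p x * poly (Q (Suc n * p + r)) x - poly (Q (n * p + r)) x" for n
      using jacobi_poly_period_recurrence[OF per, of "cos \<theta>" "sin \<theta>" "n * p + r" x]
      unfolding Q_def by (simp add: mult_2 add_ac del: jacobi_poly.simps)
    note node = chebyshev_recurrence_at_node[of "\<lambda>n. poly (Q (n * p + r)) x", OF rec]
    show "poly (Q (m * p + r)) x = \<sigma> * (- 1) ^ k * poly (Q r) x"
    proof (cases "even (p - j)")
      case True
      have "1 - real k / real m = real (m - k) / real m" using k by (simp add: of_nat_diff field_simps)
      then have "discriminant V p x = 2 * cos (pi * (real (m - k) / real m))"
        using discriminant_eq_cos_band_fraction[OF bands j x(1)] x(2) True by simp
      then have "poly (Q (m * p + r)) x = (- 1) ^ (m - k) * poly (Q r) x"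
        using node[of "m - k" m] k by simp
      moreover have "(- 1 :: real) ^ (m - k) = (- 1) ^ m * (- 1) ^ k"
        using k by (simp add: minus_one_power_iff)
      ultimately show ?thesis using True by (simp add: \<sigma>_def)
    next
      case False
      then have "discriminant V p x = 2 * cos (pi * (real k / real m))"
        using discriminant_eq_cos_band_fraction[OF bands j x(1)] x(2) by simp
      then show ?thesis using node[of k m] k False by (simp add: \<sigma>_def)
    qed
  qed (use nz r cd in auto)
  moreover have "card {x. poly (Q r) x = 0} \<le> p"
  proof -
    obtain q where "r = Suc q" using r by (cases r) auto
    then have "degree (Q r) \<le> p" using jacobi_poly_degree_Suc[of V "cos \<theta>" "sin \<theta>" q] r by (simp add: Q_def)
    then show ?thesis using card_poly_roots_bound[OF nz[OF r(1)]] by linarith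
  qed
  ultimately show ?thesis unfolding Q_def by linarith
qed

text \<open>The share of the states of band \<open>j\<close> lying at or below \<open>E\<close>. The
  first two cases fix the values off the band, where \<open>D / 2\<close> may leave the domain of
  \<open>arccos\<close>.\<close>

definition states_below :: "(int \<Rightarrow> real) \<Rightarrow> nat \<Rightarrow> (nat \<Rightarrow> real) \<Rightarrow> (nat \<Rightarrow> real) \<Rightarrow> real \<Rightarrow> nat \<Rightarrow> real" where
  "states_below V p a b E j =
     (if E \<le> a j then 0 else if b j \<le> E then 1 else band_fraction V p j E)"

lemma band_fraction_endpoints:
  assumes p: "p \<ge> 1" and bands: "spectral_bands V p a b" and j: "j \<in> {1..p}"
  shows "band_fraction V p j (a j) = 0" "band_fraction V p j (b j) = 1"
proof -
  have 1: "bij_betw (band_fraction V p j) {a j..b j} {0..1}"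
    unfolding bij_betw_def using band_fraction_image[OF bands j]
      strict_mono_on_imp_inj_on[OF strict_mono_on_band_fraction[OF assms]] by simp
  have 2: "mono_on {a j..b j} (band_fraction V p j)"
    by (rule strict_mono_on_imp_mono_on[OF strict_mono_on_band_fraction[OF assms]])
  have "a j \<le> b j" using bands j by (auto simp: spectral_bands_def less_imp_le)
  from mono_bij_betw_endpoints[OF 1 2 this]
  show "band_fraction V p j (a j) = 0" "band_fraction V p j (b j) = 1" by auto
qed

text \<open>Open intervals are used so that touching bands stay disjoint and no root is counted
  twice.\<close>

lemma sum_card_bands_le:
  fixes a b :: "nat \<Rightarrow> real"
  assumes bands: "spectral_bands V p a b" and fin: "finite S"
  shows "(\<Sum>j\<in>{1..p}. card {x\<in>S. a j < x \<and> x < b j}) \<le> card S"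
proof -
  have "{x\<in>S. a i < x \<and> x < b i} \<inter> {x\<in>S. a j < x \<and> x < b j} = {}"
    if "i \<in> {1..p}" "j \<in> {1..p}" "i \<noteq> j" for i j
    using that spectral_bands_le[OF bands, of i j] spectral_bands_le[OF bands, of j i]
    by (cases i j rule: linorder_cases) force+
  then have "(\<Sum>j\<in>{1..p}. card {x\<in>S. a j < x \<and> x < b j}) = card (\<Union>j\<in>{1..p}. {x\<in>S. a j < x \<and> x < b j})"
    using fin by (subst card_UN_disjoint) auto
  also have "\<dots> \<le> card S" using fin by (intro card_mono) auto
  finally show ?thesis .
qed

text \<open>\<open>K\<close> is the number of states per period up to \<open>E\<close>. The bands
  give lower bounds for the roots up to \<open>E\<close> and for those above it; the degree bound
  turns the second into an upper bound for the first.\<close>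

lemma card_jacobi_poly_roots_le:
  fixes E \<theta> :: real and m :: nat and a b :: "nat \<Rightarrow> real"
  assumes p: "p \<ge> 1" and per: "periodic_potential V p" and bands: "spectral_bands V p a b"
    and r: "2 \<le> r" "r \<le> Suc p"
  defines "K \<equiv> \<Sum>j\<in>{1..p}. states_below V p a b E j"
  defines "N \<equiv> card {x. x \<le> E \<and> poly (jacobi_poly V (cos \<theta>) (sin \<theta>) (m * p + r)) x = 0}"
  shows "\<bar>real N - real m * K\<bar> \<le> real p * (3 + real p)"
proof -
  define F where "F = jacobi_poly V (cos \<theta>) (sin \<theta>) (m * p + r)"
  define N' where "N' = card {x. E < x \<and> poly F x = 0}"
  have "cos \<theta> \<noteq> 0 \<or> sin \<theta> \<noteq> 0" using cos_one_sin_zero sin_zero_abs_cos_one by fastforce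
  then have nz: "F \<noteq> 0" unfolding F_def using r by (intro jacobi_poly_nonzero) auto
  have fin: "finite {x. poly F x = 0}" by (rule poly_roots_finite[OF nz])
  have fin': "finite {x. P x \<and> poly F x = 0}" for P by (rule finite_subset[OF _ fin]) auto
  define A where "A = (\<lambda>j. {x\<in>{x. x \<le> E \<and> poly F x = 0}. a j < x \<and> x < b j})"
  define B where "B = (\<lambda>j. {x\<in>{x. E < x \<and> poly F x = 0}. a j < x \<and> x < b j})"
  have A: "real m * states_below V p a b E j - (2 + real p) \<le> real (card (A j))"
    and B: "real m * (1 - states_below V p a b E j) - (2 + real p) \<le> real (card (B j))"
    if j: "j \<in> {1..p}" for j
  proof -
    have ab: "a j < b j" using bands j by (auto simp: spectral_bands_def)
    have cnt: "real m * (band_fraction V p j d - band_fraction V p j c) - (2 + real p) \<le> real (card S)"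
      if "a j \<le> c" "c \<le> d" "d \<le> b j" "{x. c < x \<and> x < d \<and> poly F x = 0} \<subseteq> S" "finite S" for c d S
      using card_jacobi_poly_roots_in_band[OF p per bands j r that(1-3), of m \<theta>] card_mono[OF that(5,4)]
      unfolding F_def by linarith
    have finAB: "finite (A j)" "finite (B j)" unfolding A_def B_def by (auto intro: finite_subset[OF _ fin])
    note e = band_fraction_endpoints[OF p bands j]
    consider "E \<le> a j" | "b j \<le> E" "a j < E" | "a j < E" "E < b j" by linarith
    then have "real m * states_below V p a b E j - (2 + real p) \<le> real (card (A j)) \<and>
      real m * (1 - states_below V p a b E j) - (2 + real p) \<le> real (card (B j))"
    proof cases
      case 1
      then have "{x. a j < x \<and> x < b j \<and> poly F x = 0} \<subseteq> B j" by (auto simp: B_def)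
      from cnt[OF _ _ _ this finAB(2)] show ?thesis using 1 ab by (simp add: states_below_def e)
    next
      case 2
      then have "{x. a j < x \<and> x < b j \<and> poly F x = 0} \<subseteq> A j" by (auto simp: A_def)
      from cnt[OF _ _ _ this finAB(1)] show ?thesis using 2 ab by (simp add: states_below_def e)
    next
      case 3
      then have "{x. a j < x \<and> x < E \<and> poly F x = 0} \<subseteq> A j"
        "{x. E < x \<and> x < b j \<and> poly F x = 0} \<subseteq> B j" by (auto simp: A_def B_def)
      from cnt[OF _ _ _ this(1) finAB(1)] cnt[OF _ _ _ this(2) finAB(2)]
      show ?thesis using 3 by (simp add: states_below_def e)
    qed
    then show "real m * states_below V p a b E j - (2 + real p) \<le> real (card (A j))"
      and "real m * (1 - states_below V p a b E j) - (2 + real p) \<le> real (card (B j))" by auto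
  qed
  have "real m * K - real p * (2 + real p) = (\<Sum>j\<in>{1..p}. real m * states_below V p a b E j - (2 + real p))"
    by (simp add: K_def sum_subtractf sum_distrib_left)
  also have "\<dots> \<le> (\<Sum>j\<in>{1..p}. real (card (A j)))" by (rule sum_mono) (rule A)
  also have "\<dots> \<le> real N"
    using sum_card_bands_le[OF bands fin', of "\<lambda>x. x \<le> E"] unfolding A_def N_def F_def
    by (simp flip: of_nat_sum)
  finally have 1: "real m * K - real p * (2 + real p) \<le> real N" .
  have "real m * (real p - K) - real p * (2 + real p) =
      (\<Sum>j\<in>{1..p}. real m * (1 - states_below V p a b E j) - (2 + real p))"
    by (simp add: K_def sum_subtractf sum_distrib_left right_diff_distrib mult.commute)
  also have "\<dots> \<le> (\<Sum>j\<in>{1..p}. real (card (B j)))" by (rule sum_mono) (rule B)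
  also have "\<dots> \<le> real N'"
    using sum_card_bands_le[OF bands fin', of "\<lambda>x. E < x"] unfolding B_def N'_def
    by (simp flip: of_nat_sum)
  finally have 2: "real m * (real p - K) - real p * (2 + real p) \<le> real N'" .
  have "N + N' = card ({x. x \<le> E \<and> poly F x = 0} \<union> {x. E < x \<and> poly F x = 0})"
    unfolding N_def N'_def F_def[symmetric] by (intro card_Un_disjoint[symmetric] fin') auto
  also have "{x. x \<le> E \<and> poly F x = 0} \<union> {x. E < x \<and> poly F x = 0} = {x. poly F x = 0}" by auto
  also have "card \<dots> \<le> degree F" by (rule card_poly_roots_bound[OF nz])
  also have "\<dots> \<le> m * p + p"
  proof -
    obtain q where q: "r = Suc q" using r by (cases r) auto
    then show ?thesis using jacobi_poly_degree_Suc[of V "cos \<theta>" "sin \<theta>" "m * p + q"] r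
      unfolding F_def q by simp
  qed
  finally have "real (N + N') \<le> real (m * p + p)" by (simp only: of_nat_le_iff)
  then have "real N + real N' \<le> real m * real p + real p" by simp
  \<comment> \<open>From \<open>N \<le> m p + p - N'\<close> and the bound for \<open>N'\<close>
    follows \<open>N \<le> m K + p + p (2 + p)\<close>, whence the constant
    \<open>p (3 + p)\<close>.\<close>
  with 1 2 show ?thesis by (simp add: abs_le_iff algebra_simps)
qed

lemma states_below_bounds:
  assumes "spectral_bands V p a b" "j \<in> {1..p}"
  shows "0 \<le> states_below V p a b E j" "states_below V p a b E j \<le> 1"
proof -
  have "band_fraction V p j E \<in> {0..1}" if "E \<in> {a j..b j}"
    using band_fraction_image[OF assms] that by blast
  then show "0 \<le> states_below V p a b E j" "states_below V p a b E j \<le> 1"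
    by (auto simp: states_below_def)
qed

lemma ids_restricted_tendsto:
  fixes E \<theta> :: real and a b :: "nat \<Rightarrow> real"
  assumes p: "p \<ge> 1" and per: "periodic_potential V p" and bands: "spectral_bands V p a b"
  shows "(\<lambda>L. ids_restricted V \<theta> L E) \<longlonglongrightarrow> (\<Sum>j\<in>{1..p}. states_below V p a b E j) / real p"
proof -
  define K where "K = (\<Sum>j\<in>{1..p}. states_below V p a b E j)"
  define C where "C = real p * (3 + real p) + real p"
  have "0 \<le> K" unfolding K_def by (intro sum_nonneg states_below_bounds(1)[OF bands])
  have "K \<le> (\<Sum>j\<in>{1..p}. 1)" unfolding K_def by (intro sum_mono states_below_bounds(2)[OF bands])
  then have "K \<le> real p" by simp
  have bound: "norm (ids_restricted V \<theta> L E - K / real p) \<le> 2 * C / real L" if L: "L \<ge> 2" for L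
  proof -
    \<comment> \<open>Division of \<open>L - 2\<close> rather than \<open>L\<close> puts the
      remainder \<open>r\<close> into \<open>2..p + 1\<close>.\<close>
    define m where "m = (L - 2) div p"
    define r where "r = (L - 2) mod p + 2"
    define N where "N = card {x. x \<le> E \<and> poly (jacobi_poly V (cos \<theta>) (sin \<theta>) L) x = 0}"
    have Lm: "L = m * p + r" using L by (simp add: m_def r_def)
    have "(L - 2) mod p < p" using p by simp
    then have r: "2 \<le> r" "r \<le> Suc p" by (auto simp: r_def)
    have N: "\<bar>real N - real m * K\<bar> \<le> real p * (3 + real p)"
      unfolding N_def K_def Lm by (rule card_jacobi_poly_roots_le[OF p per bands r])
    \<comment> \<open>Since \<open>L - 1 = m p + (r - 1)\<close>, replacing \<open>m K\<close> by
      \<open>(L - 1) K / p\<close> costs \<open>(r - 1) K / p\<close>, at most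
      \<open>p\<close>.\<close>
    have e: "real N - (real L - 1) * (K / real p) = (real N - real m * K) - (real r - 1) * (K / real p)"
      using p by (simp add: Lm field_simps)
    have "\<bar>(real r - 1) * (K / real p)\<bar> \<le> real p * 1"
      unfolding abs_mult using r p \<open>0 \<le> K\<close> \<open>K \<le> real p\<close> by (intro mult_mono) auto
    then have *: "\<bar>real N - (real L - 1) * (K / real p)\<bar> \<le> C"
      unfolding e C_def using N by linarith
    have "ids_restricted V \<theta> L E - K / real p = (real N - (real L - 1) * (K / real p)) / (real L - 1)"
      unfolding ids_restricted_eq[OF L] N_def using L by (simp add: diff_divide_distrib)
    then have "norm (ids_restricted V \<theta> L E - K / real p) = \<bar>real N - (real L - 1) * (K / real p)\<bar> / (real L - 1)"
      using L by (simp add: abs_divide)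
    \<comment> \<open>For \<open>L \<ge> 2\<close> one has \<open>L - 1 \<ge> L / 2\<close>.\<close>
    also have "\<dots> \<le> C / (real L / 2)"
      using * L by (intro frac_le) auto
    finally show ?thesis by (simp add: mult.commute)
  qed
  have "(\<lambda>L. ids_restricted V \<theta> L E - K / real p) \<longlonglongrightarrow> 0"
    by (rule Lim_null_comparison[OF _ lim_const_over_n[of "2 * C"]])
      (use bound in \<open>auto simp: eventually_sequentially\<close>)
  then show ?thesis unfolding K_def by (simp add: LIM_zero_iff)
qed

section \<open>Closed form of the integrated density of states\<close>

lemma ids_eq:
  assumes "p \<ge> 1" "periodic_potential V p" "spectral_bands V p a b"
  shows "ids V E = (\<Sum>j\<in>{1..p}. states_below V p a b E j) / real p"
  unfolding ids_def
  \<comment> \<open>The limit found is the same for every \<theta>, and uniqueness of limits makes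
    the description definite.\<close>
  using ids_restricted_tendsto[OF assms] by (intro the_equality) (auto intro: LIMSEQ_unique)

text \<open>For \<theta> in \<open>[0, pi / p]\<close> the angle \<open>p \<theta>\<close> lies in
  \<open>[0, pi]\<close>, where \<open>arccos\<close> inverts the cosine.\<close>

lemma bloch_angle_eq:
  assumes p: "p \<ge> 1" and D: "discriminant V p E \<in> {-2..2}"
  shows "bloch_angle V p E = arccos (discriminant V p E / 2) / real p"
  unfolding bloch_angle_def
proof (rule the_equality)
  show "arccos (discriminant V p E / 2) / real p \<in> {0..pi / real p} \<and>
      discriminant V p E = 2 * cos (real p * (arccos (discriminant V p E / 2) / real p))"
    using p D by (auto simp: arccos_lbound arccos_ubound divide_right_mono)
next
  fix \<theta> assume \<theta>: "\<theta> \<in> {0..pi / real p} \<and> discriminant V p E = 2 * cos (real p * \<theta>)"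
  then have "arccos (discriminant V p E / 2) = real p * \<theta>"
    using p by (simp add: arccos_cos field_simps)
  then show "\<theta> = arccos (discriminant V p E / 2) / real p" using p by simp
qed

text \<open>Bands up to \<open>j\<close> are full and those from \<open>j + 2\<close> on are empty,
  so only band \<open>j + 1\<close> can be partly filled. This serves gaps and bands alike.\<close>

lemma sum_states_below:
  assumes p: "p \<ge> 1" and bands: "spectral_bands V p a b" and j: "j \<le> p"
    and lo: "\<And>i. i \<in> {1..j} \<Longrightarrow> b i \<le> E" and hi: "\<And>i. i \<in> {Suc (Suc j)..p} \<Longrightarrow> E \<le> a i"
  shows "(\<Sum>i\<in>{1..p}. states_below V p a b E i) =
    real j + (if j < p then states_below V p a b E (Suc j) else 0)"
proof -
  have ab: "a i < b i" if "i \<in> {1..p}" for i using bands that by (auto simp: spectral_bands_def)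
  have l: "states_below V p a b E i = 1" if "i \<in> {1..j}" for i
    using lo[OF that] ab[of i] that j by (auto simp: states_below_def)
  have h: "states_below V p a b E i = 0" if "i \<in> {Suc (Suc j)..p}" for i
    using hi[OF that] by (auto simp: states_below_def)
  have "{1..p} = {1..j} \<union> {Suc j..p}" using j by auto
  then have "(\<Sum>i\<in>{1..p}. states_below V p a b E i) =
      (\<Sum>i\<in>{1..j}. states_below V p a b E i) + (\<Sum>i\<in>{Suc j..p}. states_below V p a b E i)"
    by (simp add: sum.union_disjoint)
  also have "(\<Sum>i\<in>{1..j}. states_below V p a b E i) = real j" using l by simp
  also have "(\<Sum>i\<in>{Suc j..p}. states_below V p a b E i) = (if j < p then states_below V p a b E (Suc j) else 0)"
    using h j by (auto simp: sum.atLeast_Suc_atMost)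
  finally show ?thesis .
qed

theorem theorem1p1:
  fixes p :: nat and V :: "int \<Rightarrow> real" and a b :: "nat \<Rightarrow> real"
  assumes "p \<ge> 1"
    and "periodic_potential V p"
    and "spectral_bands V p a b"
  shows "(\<forall>j\<in>{0..p}. \<forall>E\<in>spectral_gap p a b j. ids V E = real j / real p) \<and>
    (\<forall>j\<in>{1..p}. \<forall>E\<in>{a j..b j}.
       (even (p - j) \<longrightarrow> ids V E = real j / real p - bloch_angle V p E / pi) \<and>
       (odd (p - j) \<longrightarrow> ids V E = (real j - 1) / real p + bloch_angle V p E / pi))"
proof (intro conjI ballI)
  note bands = assms(3)
  have ab: "a i < b i" if "i \<in> {1..p}" for i using bands that by (auto simp: spectral_bands_def)
  have le: "b i \<le> a j" if "1 \<le> i" "i < j" "j \<le> p" for i j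
    by (rule spectral_bands_le[OF bands that])
  fix j E assume j: "j \<in> {0..p}" and E: "E \<in> spectral_gap p a b j"
  have lo0: "b j \<le> E" if "1 \<le> j" using E that by (auto simp: spectral_gap_def split: if_splits)
  have lo: "b i \<le> E" if "i \<in> {1..j}" for i
    using that le[of i j] ab[of j] lo0 j by (cases "i = j") fastforce+
  \<comment> \<open>In a collapsed gap \<open>E\<close> is \<open>b j\<close>, and the ordering of
    the bands gives the bound; it makes the contribution of band \<open>j + 1\<close>
    vanish.\<close>
  have hi0: "E \<le> a (Suc j)" if "j < p"
    using E that le[of j "Suc j"] by (auto simp: spectral_gap_def split: if_splits)
  have hi: "E \<le> a i" if "i \<in> {Suc (Suc j)..p}" for i
    using that le[of "Suc j" i] ab[of "Suc j"] hi0 by fastforce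
  have "(\<Sum>i\<in>{1..p}. states_below V p a b E i) = real j"
    using sum_states_below[OF assms(1) bands _ lo hi] j hi0 by (simp add: states_below_def)
  then show "ids V E = real j / real p" using ids_eq[OF assms] by simp
next
  note bands = assms(3)
  have ab: "a i < b i" if "i \<in> {1..p}" for i using bands that by (auto simp: spectral_bands_def)
  have le: "b i \<le> a j" if "1 \<le> i" "i < j" "j \<le> p" for i j
    by (rule spectral_bands_le[OF bands that])
  fix j E assume j: "j \<in> {1..p}" and E: "E \<in> {a j..b j}"
  obtain k where k: "j = Suc k" using j by (cases j) auto
  have lo: "b i \<le> E" if "i \<in> {1..k}" for i
    using that le[of i j] E j k by fastforce
  have hi: "E \<le> a i" if "i \<in> {Suc (Suc k)..p}" for i
    using that le[of j i] E j k by fastforce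
  \<comment> \<open>At the two ends the fixed values 0 and 1 agree with the band fraction.\<close>
  have "states_below V p a b E j = band_fraction V p j E"
    using E ab[OF j] band_fraction_endpoints[OF assms(1) bands j]
    by (cases "E = a j"; cases "E = b j") (auto simp: states_below_def)
  then have "(\<Sum>i\<in>{1..p}. states_below V p a b E i) = (real j - 1) + band_fraction V p j E"
    using sum_states_below[OF assms(1) bands, of k E] lo hi j k by simp
  then have ids: "ids V E = ((real j - 1) + band_fraction V p j E) / real p" using ids_eq[OF assms] by simp
  note angle = bloch_angle_eq[OF assms(1) discriminant_in_band[OF bands j E]]
  show "even (p - j) \<longrightarrow> ids V E = real j / real p - bloch_angle V p E / pi"
    unfolding ids angle using assms(1) by (simp add: band_fraction_def field_simps)
  show "odd (p - j) \<longrightarrow> ids V E = (real j - 1) / real p + bloch_angle V p E / pi"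
    unfolding ids angle using assms(1) by (simp add: band_fraction_def field_simps)
qed

end
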